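(* Let $Q=[Q_1,\dots,Q_n]^\top$ be an $\mathbb{R}^n$-valued random variable and, for a given design parameter vector $d\in\mathcal{D}\subset\mathbb{R}^{\delta}$, let $Y_d = h(Q,d)+\Xi$ be the $\mathbb{R}^m$-valued observational random variable, where $h$ is a deterministic observational map and $\Xi$ is an $\mathbb{R}^m$-valued measurement error. Assume that $Q$, $Y_d$ and $\Xi$ have finite variances and absolutely continuous distributions. Then the total expected conditional variance $$V(d)=\sum_{i=1}^n \operatorname{E}\bigl[\operatorname{Var}[Q_i\mid Y_d]\bigr]$$ can be expressed using the conditional expectation $\operatorname{E}[Q\mid Y_d]$ as $$V(d)=\operatorname{E}\Bigl[\bigl\lVert Q-\operatorname{E}[Q\mid Y_d]\bigr\rVert_2^2\Bigr].$$
   Context: All random variables live on a common probability space $(\Omega,\mathfrak{A},\mathbb{P})$. The density of $Q$ is $\pi_Q$, that of $\Xi$ is $\pi_\Xi$, and $\Xi$ is independent of $Q$, so that the posterior density of $Q$ given $Y_d=y$ is $$\pi_{Q\mid Y_d}(q\mid y)=\frac{\pi_Q(q)\,\pi_\Xi(y-h(q,d))}{\int_{\mathbb{R}^n}\pi_Q(q')\,\pi_\Xi(y-h(q',d))\,\mathrm{d}q'}.$$ The conditional variance $\operatorname{Var}[Q_i\mid Y_d]$ is the random variable obtained by evaluating at $y=Y_d(\omega)$ the posterior variance $$\int_{\mathbb{R}^n} q_i^2\,\pi_{Q\mid Y_d}(q\mid y)\,\mathrm{d}q-\Bigl(\int_{\mathbb{R}^n} q_i\,\pi_{Q\mid Y_d}(q\mid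 y)\,\mathrm{d}q\Bigr)^2 .$$ The conditional expectation $\operatorname{E}[Q\mid Y_d]$ is the usual ($\sigma(Y_d)$-measurable, $\mathbb{R}^n$-valued) conditional expectation of $Q$ given the $\sigma$-algebra generated by $Y_d$, and $\lVert\cdot\rVert_2$ is the Euclidean norm on $\mathbb{R}^n$. *)

theory Defs
  imports "HOL-Probability.Probability"
begin

definition finite_variance :: "'a measure \<Rightarrow> ('a \<Rightarrow> real ^ 'n) \<Rightarrow> bool" where
  "finite_variance M X \<longleftrightarrow>
     (\<forall>i. integrable M (\<lambda>\<omega>. X \<omega> $ i) \<and>
          integrable M (\<lambda>\<omega>. (X \<omega> $ i - (\<integral>\<omega>'. X \<omega>' $ i \<partial>M))\<^sup>2))"

text \<open>The library's \<open>indep_var\<close> requires both variables to have the same value type. The general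
  notion is independence of the generated \<open>\<sigma>\<close>-algebras, where
  \<^term>\<open>vimage_algebra (space M) X borel\<close> is the \<open>\<sigma>\<close>-algebra generated by \<open>X\<close>.\<close>

definition indep_rvs ::
  "'a measure \<Rightarrow> ('a \<Rightarrow> 'b::topological_space) \<Rightarrow> ('a \<Rightarrow> 'c::topological_space) \<Rightarrow> bool" where
  "indep_rvs M X Y \<longleftrightarrow>
     prob_space.indep_set M (sets (vimage_algebra (space M) X borel))
                            (sets (vimage_algebra (space M) Y borel))"

definition observation ::
  "(real ^ 'n \<Rightarrow> real ^ 'k \<Rightarrow> real ^ 'm) \<Rightarrow> ('a \<Rightarrow> real ^ 'n) \<Rightarrow> ('a \<Rightarrow> real ^ 'm) \<Rightarrow> real ^ 'k
    \<Rightarrow> 'a \<Rightarrow> real ^ 'm" where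
  "observation h Q \<Xi> d \<omega> = h (Q \<omega>) d + \<Xi> \<omega>"

text \<open>Where the normalising integral vanishes or diverges, the total operations of HOL make
  the posterior density 0. This concerns only a set of values \<open>y\<close> that \<open>Y\<^sub>d\<close> hits with
  probability 0.\<close>

definition posterior_density ::
  "(real ^ 'n \<Rightarrow> real) \<Rightarrow> (real ^ 'm \<Rightarrow> real) \<Rightarrow> (real ^ 'n \<Rightarrow> real ^ 'k \<Rightarrow> real ^ 'm) \<Rightarrow> real ^ 'k
    \<Rightarrow> real ^ 'm \<Rightarrow> real ^ 'n \<Rightarrow> real" where
  "posterior_density \<pi>Q \<pi>\<Xi> h d y q =
     \<pi>Q q * \<pi>\<Xi> (y - h q d) / (\<integral>q'. \<pi>Q q' * \<pi>\<Xi> (y - h q' d) \<partial>lborel)"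

definition posterior_variance ::
  "(real ^ 'n \<Rightarrow> real) \<Rightarrow> (real ^ 'm \<Rightarrow> real) \<Rightarrow> (real ^ 'n \<Rightarrow> real ^ 'k \<Rightarrow> real ^ 'm) \<Rightarrow> real ^ 'k
    \<Rightarrow> 'n \<Rightarrow> real ^ 'm \<Rightarrow> real" where
  "posterior_variance \<pi>Q \<pi>\<Xi> h d i y =
     (\<integral>q. (q $ i)\<^sup>2 * posterior_density \<pi>Q \<pi>\<Xi> h d y q \<partial>lborel)
       - (\<integral>q. q $ i * posterior_density \<pi>Q \<pi>\<Xi> h d y q \<partial>lborel)\<^sup>2"

definition total_expected_cond_variance ::
  "'a measure \<Rightarrow> ('a \<Rightarrow> real ^ 'n) \<Rightarrow> ('a \<Rightarrow> real ^ 'm) \<Rightarrow> (real ^ 'n \<Rightarrow> real) \<Rightarrow> (real ^ 'm \<Rightarrow> real)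
    \<Rightarrow> (real ^ 'n \<Rightarrow> real ^ 'k \<Rightarrow> real ^ 'm) \<Rightarrow> real ^ 'k \<Rightarrow> real" where
  "total_expected_cond_variance M Q \<Xi> \<pi>Q \<pi>\<Xi> h d =
     (\<Sum>i\<in>UNIV. \<integral>\<omega>. posterior_variance \<pi>Q \<pi>\<Xi> h d i (observation h Q \<Xi> d \<omega>) \<partial>M)"

text \<open>The library's conditional expectation is real-valued; vectors are treated componentwise.\<close>

definition vec_cond_exp ::
  "'a measure \<Rightarrow> ('a \<Rightarrow> real ^ 'm) \<Rightarrow> ('a \<Rightarrow> real ^ 'n) \<Rightarrow> 'a \<Rightarrow> real ^ 'n" where
  "vec_cond_exp M Y X \<omega> =
     (\<chi> i. real_cond_exp M (vimage_algebra (space M) Y borel) (\<lambda>\<omega>'. X \<omega>' $ i) \<omega>)"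

end

theory Submission
  imports Defs
begin

text \<open>The pair \<open>(Q, Y\<^sub>d)\<close> has joint density \<open>\<pi>\<^sub>Q(q) \<pi>\<^sub>\<Xi>(y - h(q,d))\<close>, by independence and the shear
  \<open>(q, x) \<mapsto> (q, h(q,d) + x)\<close>. Hence by Fubini the posterior mean of \<open>\<phi>(Q)\<close>, evaluated at \<open>Y\<^sub>d\<close>, is
  a version of the conditional expectation of \<open>\<phi>(Q)\<close>; taking \<open>\<phi>(q) = q\<^sub>i\<close> and
  \<open>\<phi>(q) = q\<^sub>i\<^sup>2\<close> identifies the posterior variance with the conditional variance. Its expectation
  is the mean square error, because \<open>Q\<^sub>i - E[Q\<^sub>i | Y\<^sub>d]\<close> is orthogonal to \<open>E[Q\<^sub>i | Y\<^sub>d]\<close>.\<close>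

text \<open>Measurable rectangles generate the product sigma-algebra and are closed under
  intersection, and on a rectangle the independence of the two generated sigma-algebras is the
  product formula. This puts \<open>indep_rvs\<close> in the form from which a joint density can be
  read off.\<close>

lemma (in prob_space) indep_rvs_distr_pair:
  fixes X :: "'a \<Rightarrow> 'b::topological_space" and Y :: "'a \<Rightarrow> 'c::topological_space"
  assumes [measurable]: "X \<in> borel_measurable M" "Y \<in> borel_measurable M"
    and ind: "indep_rvs M X Y"
  shows "distr M borel X \<Otimes>\<^sub>M distr M borel Y = distr M (borel \<Otimes>\<^sub>M borel) (\<lambda>\<omega>. (X \<omega>, Y \<omega>))"
proof (rule pair_measure_eqI)
  interpret PX: prob_space "distr M borel X" by (rule prob_space_distr) simp
  interpret PY: prob_space "distr M borel Y" by (rule prob_space_distr) simp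
  show "sigma_finite_measure (distr M borel X)" "sigma_finite_measure (distr M borel Y)" ..
  fix A B
  assume "A \<in> sets (distr M borel X)" "B \<in> sets (distr M borel Y)"
  then have [measurable]: "A \<in> sets borel" "B \<in> sets borel" by simp_all
  have "prob ((X -` A \<inter> space M) \<inter> (Y -` B \<inter> space M)) =
      prob (X -` A \<inter> space M) * prob (Y -` B \<inter> space M)"
    using ind unfolding indep_rvs_def
    by (rule indep_setD) (auto intro: in_vimage_algebra)
  moreover have "(X -` A \<inter> space M) \<inter> (Y -` B \<inter> space M) = (\<lambda>\<omega>. (X \<omega>, Y \<omega>)) -` (A \<times> B) \<inter> space M"
    by auto
  ultimately show "emeasure (distr M borel X) A * emeasure (distr M borel Y) B =
      emeasure (distr M (borel \<Otimes>\<^sub>M borel) (\<lambda>\<omega>. (X \<omega>, Y \<omega>))) (A \<times> B)"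
    by (simp add: emeasure_distr emeasure_eq_measure ennreal_mult)
qed (simp cong: sets_pair_measure_cong)

text \<open>For fixed \<open>x\<close> the shear is a translation by \<open>g x\<close> in the
  second coordinate. Translations preserve Lebesgue measure, so no Jacobian factor appears and
  measurability of \<open>g\<close> suffices.\<close>

lemma distributed_shear:
  fixes X :: "'a \<Rightarrow> 'b::euclidean_space" and E :: "'a \<Rightarrow> 'c::euclidean_space"
  assumes D: "distributed M (lborel \<Otimes>\<^sub>M lborel) (\<lambda>\<omega>. (X \<omega>, E \<omega>)) f"
    and [measurable]: "g \<in> borel_measurable borel"
  shows "distributed M (lborel \<Otimes>\<^sub>M lborel) (\<lambda>\<omega>. (X \<omega>, g (X \<omega>) + E \<omega>)) (\<lambda>(x, y). f (x, y - g x))"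
proof -
  have f[measurable]: "f \<in> borel_measurable (borel \<Otimes>\<^sub>M borel)"
    using distributed_borel_measurable[OF D] by (simp add: lborel_prod borel_prod)
  have XE: "(\<lambda>\<omega>. (X \<omega>, E \<omega>)) \<in> M \<rightarrow>\<^sub>M borel \<Otimes>\<^sub>M borel"
    using distributed_measurable[OF D] by (simp add: lborel_prod borel_prod)
  have [measurable]: "X \<in> borel_measurable M" "E \<in> borel_measurable M"
    using measurable_comp[OF XE measurable_fst] measurable_comp[OF XE measurable_snd]
    by (simp_all add: comp_def)
  have "emeasure (distr M (lborel \<Otimes>\<^sub>M lborel) (\<lambda>\<omega>. (X \<omega>, g (X \<omega>) + E \<omega>))) A =
      emeasure (density (lborel \<Otimes>\<^sub>M lborel) (\<lambda>(x, y). f (x, y - g x))) A"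
    if "A \<in> sets (borel \<Otimes>\<^sub>M borel)" for A
  proof -
    note that[measurable]
    have "emeasure (distr M (lborel \<Otimes>\<^sub>M lborel) (\<lambda>\<omega>. (X \<omega>, g (X \<omega>) + E \<omega>))) A =
        (\<integral>\<^sup>+\<omega>. indicator A (X \<omega>, g (X \<omega>) + E \<omega>) \<partial>M)"
      by (subst nn_integral_indicator[symmetric], simp, subst nn_integral_distr) simp_all
    also have "\<dots> = (\<integral>\<^sup>+z. f z * indicator A (fst z, g (fst z) + snd z) \<partial>(lborel \<Otimes>\<^sub>M lborel))"
      by (subst distributed_nn_integral[OF D]) simp_all
    also have "\<dots> = (\<integral>\<^sup>+x. \<integral>\<^sup>+y. f (x, y) * indicator A (x, g x + y) \<partial>lborel \<partial>lborel)"
      by (subst lborel.nn_integral_fst[symmetric]) simp_all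
    also have "\<dots> = (\<integral>\<^sup>+x. \<integral>\<^sup>+y. f (x, y - g x) * indicator A (x, y) \<partial>lborel \<partial>lborel)"
    proof (rule nn_integral_cong)
      fix x
      show "(\<integral>\<^sup>+y. f (x, y) * indicator A (x, g x + y) \<partial>lborel) =
          (\<integral>\<^sup>+y. f (x, y - g x) * indicator A (x, y) \<partial>lborel)"
        \<comment> \<open>Only the measure on the right-hand side is rewritten, as its own image
          under translation by \<open>g x\<close>; the change of variables then turns
          \<open>y\<close> into \<open>g x + y\<close> there.\<close>
        by (subst (2) lborel_distr_plus[of "g x", symmetric], subst nn_integral_distr) simp_all
    qed
    also have "\<dots> = emeasure (density (lborel \<Otimes>\<^sub>M lborel) (\<lambda>(x, y). f (x, y - g x))) A"
      by (simp add: emeasure_density lborel.nn_integral_fst[symmetric])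
    finally show ?thesis .
  qed
  then show ?thesis
    unfolding distributed_def by (auto intro!: measure_eqI)
qed

text \<open>With \<open>?C\<close> for the conditional expectation, both integrals reduce to E[f^2]
  - E[?C^2]: on the left by orthogonality, on the right because conditioning preserves the mean of
  f^2.\<close>

lemma (in prob_space) cond_exp_square_error:
  assumes sub: "subalgebra M F" and [measurable]: "f \<in> borel_measurable M"
    and i2: "integrable M (\<lambda>x. (f x)\<^sup>2)"
  shows "integrable M (\<lambda>x. (f x - real_cond_exp M F f x)\<^sup>2)"
    and "(\<integral>x. (f x - real_cond_exp M F f x)\<^sup>2 \<partial>M) =
      (\<integral>x. real_cond_exp M F (\<lambda>x. (f x)\<^sup>2) x - (real_cond_exp M F f x)\<^sup>2 \<partial>M)"
proof -
  interpret finite_measure_subalgebra M F by unfold_locales (rule sub)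
  let ?C = "real_cond_exp M F f"
  have [measurable]: "?C \<in> borel_measurable M" by simp
  have i1: "integrable M f"
    using square_integrable_imp_integrable[OF _ i2] by simp
  \<comment> \<open>Conditional Jensen inequality for the convex function x^2.\<close>
  have c2: "integrable M (\<lambda>x. (?C x)\<^sup>2)"
    by (rule integrable_convex_cond_exp[where I=UNIV and q="\<lambda>x. x\<^sup>2", OF i1 _ _ i2])
       (auto intro: convex_power2)
  have fC: "integrable M (\<lambda>x. ?C x * f x)"
  proof (rule Bochner_Integration.integrable_bound[OF Bochner_Integration.integrable_add[OF c2 i2]])
    have "\<bar>a * b\<bar> \<le> a\<^sup>2 + b\<^sup>2" for a b :: real
      using sum_squares_bound[of "\<bar>a\<bar>" "\<bar>b\<bar>"] abs_ge_zero[of "a * b"]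
      by (simp only: abs_mult power2_abs)
    then show "AE x in M. norm (?C x * f x) \<le> norm ((?C x)\<^sup>2 + (f x)\<^sup>2)" by simp
  qed simp
  \<comment> \<open>Orthogonality: the factor \<open>?C\<close> is itself
    \<open>F\<close>-measurable, so the other factor \<open>f\<close> may be replaced by its
    conditional expectation under the integral.\<close>
  have eq: "(\<integral>x. ?C x * f x \<partial>M) = (\<integral>x. (?C x)\<^sup>2 \<partial>M)"
    using real_cond_exp_intg(2)[OF fC] by (simp add: power2_eq_square)
  have ex: "(f x - ?C x)\<^sup>2 = (f x)\<^sup>2 - 2 * (?C x * f x) + (?C x)\<^sup>2" for x
    by (simp add: power2_eq_square algebra_simps)
  show "integrable M (\<lambda>x. (f x - ?C x)\<^sup>2)"
    unfolding ex using i2 fC c2 by simp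
  show "(\<integral>x. (f x - ?C x)\<^sup>2 \<partial>M) = (\<integral>x. real_cond_exp M F (\<lambda>x. (f x)\<^sup>2) x - (?C x)\<^sup>2 \<partial>M)"
    unfolding ex using i2 fC c2 eq real_cond_exp_int[OF i2] by simp
qed

text \<open>Conditional expectation is characterised by its integrals over preimages under
  \<open>Y\<close> of sets \<open>B\<close>. There Fubini produces the integral of
  \<open>\<phi> x * p (x, y)\<close> over \<open>x\<close>, which is the posterior mean times the
  normaliser; the normaliser is the density of \<open>Y\<close>, so the result is again an integral
  over \<open>M\<close>.\<close>

lemma (in prob_space) real_cond_exp_eq_posterior_mean:
  fixes p :: "'b \<times> 'c \<Rightarrow> real" and \<phi> :: "'b \<Rightarrow> real"
  assumes S: "sigma_finite_measure S" and T: "sigma_finite_measure T"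
    and D: "distributed M (S \<Otimes>\<^sub>M T) (\<lambda>\<omega>. (X \<omega>, Y \<omega>)) (\<lambda>z. ennreal (p z))"
    and p0: "\<And>z. 0 \<le> p z"
    and \<phi>[measurable]: "\<phi> \<in> borel_measurable S"
    and int: "integrable M (\<lambda>\<omega>. \<phi> (X \<omega>))"
  shows "AE \<omega> in M. real_cond_exp M (vimage_algebra (space M) Y T) (\<lambda>\<omega>. \<phi> (X \<omega>)) \<omega> =
    (\<integral>x. \<phi> x * (p (x, Y \<omega>) / (\<integral>x'. p (x', Y \<omega>) \<partial>S)) \<partial>S)"
proof -
  interpret S: sigma_finite_measure S by fact
  interpret T: sigma_finite_measure T by fact
  interpret ST: pair_sigma_finite S T ..
  have p[measurable]: "p \<in> borel_measurable (S \<Otimes>\<^sub>M T)"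
    using distributed_real_measurable[OF _ D] p0 by simp
  have [measurable]: "(\<lambda>\<omega>. (X \<omega>, Y \<omega>)) \<in> M \<rightarrow>\<^sub>M S \<Otimes>\<^sub>M T"
    by (rule distributed_measurable[OF D])
  have X[measurable]: "X \<in> M \<rightarrow>\<^sub>M S" and Y[measurable]: "Y \<in> M \<rightarrow>\<^sub>M T"
    using D by (auto dest: joint_distributed_measurable1 joint_distributed_measurable2)
  let ?F = "vimage_algebra (space M) Y T"
  have YF[measurable]: "Y \<in> ?F \<rightarrow>\<^sub>M T"
    by (rule measurable_vimage_algebra1) (use measurable_space[OF Y] in auto)
  have sub: "subalgebra M ?F"
    unfolding subalgebra_def using sets_image_in_sets[OF refl Y] by simp
  interpret finite_measure_subalgebra M ?F by unfold_locales (rule sub)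

  define Z where "Z y = (\<integral>x. p (x, y) \<partial>S)" for y
  define G where "G y = (\<integral>x. \<phi> x * (p (x, y) / Z y) \<partial>S)" for y
  have [measurable]: "Z \<in> borel_measurable T" unfolding Z_def by measurable
  have [measurable]: "G \<in> borel_measurable T" unfolding G_def by measurable
  have Z0: "0 \<le> Z y" for y unfolding Z_def by (simp add: p0)
  have pint: "integrable (S \<Otimes>\<^sub>M T) p"
    using distributed_integrable[OF D, of "\<lambda>_. 1"] p0 by simp
  \<comment> \<open>\<open>Z\<close> is a Bochner integral and hence 0 where the section of
    \<open>p\<close> is not integrable. Since \<open>p\<close> has finite total mass, such
    \<open>y\<close> form a null set, and elsewhere \<open>Z\<close> agrees with the marginal
    density.\<close>
  have AEp: "AE y in T. integrable S (\<lambda>x. p (x, y))"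
    using ST.AE_integrable_snd[of "\<lambda>x y. p (x, y)"] pint by simp
  have DY: "distributed M T Y (\<lambda>y. ennreal (Z y))"
  proof (subst distributed_cong_density)
    show "distributed M T Y (\<lambda>y. \<integral>\<^sup>+x. ennreal (p (x, y)) \<partial>S)"
      by (rule distr_marginal2[OF S T D])
    show "AE y in T. ennreal (Z y) = (\<integral>\<^sup>+x. ennreal (p (x, y)) \<partial>S)"
      using AEp by eventually_elim (simp add: Z_def nn_integral_eq_integral p0)
  qed simp_all
  have \<phi>p: "integrable (S \<Otimes>\<^sub>M T) (\<lambda>(x, y). \<phi> x * p (x, y))"
    using distributed_integrable[OF D, of "\<lambda>z. \<phi> (fst z)"] p0 int
    by (simp add: case_prod_unfold mult.commute)
  have ZG: "AE y in T. Z y * G y = (\<integral>x. \<phi> x * p (x, y) \<partial>S)"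
    using AEp AE_space
  proof eventually_elim
    case (elim y)
    show ?case
    proof (cases "Z y = 0")
      \<comment> \<open>Here \<open>p (x, y) / Z y\<close> is 0 by convention, but \<open>p (\<cdot>, y)\<close> vanishes almost everywhere too.\<close>
      case True
      then have "AE x in S. p (x, y) = 0"
        using integral_nonneg_eq_0_iff_AE[OF elim(1)] p0 by (simp add: Z_def)
      then have "(\<integral>x. \<phi> x * p (x, y) \<partial>S) = (\<integral>x. 0 \<partial>S)"
        using elim(2) by (intro integral_cong_AE) auto
      with True show ?thesis by simp
    next
      case False
      then show ?thesis by (simp add: G_def)
    qed
  qed
  have ZGint: "integrable T (\<lambda>y. Z y * G y)"
    using ST.integrable_snd[OF \<phi>p] integrable_cong_AE[OF _ _ ZG] by simp
  \<comment> \<open>Under the law of \<open>Y\<close>, the function \<open>G\<close> is always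
    weighted by \<open>Z\<close>, so the product \<open>Z y * G y\<close> is all that has to be
    controlled.\<close>
  have Gint: "integrable M (\<lambda>\<omega>. G (Y \<omega>))"
    using distributed_integrable[OF DY, of G] Z0 ZGint by simp
  have "AE \<omega> in M. real_cond_exp M ?F (\<lambda>\<omega>. \<phi> (X \<omega>)) \<omega> = G (Y \<omega>)"
  proof (rule real_cond_exp_charact[OF _ int Gint])
    fix A assume "A \<in> sets ?F"
    then obtain B where [measurable]: "B \<in> sets T" and A: "A = Y -` B \<inter> space M"
      using measurable_space[OF Y] by (subst (asm) sets_vimage_algebra2) auto
    have ind: "indicator A \<omega> = (indicator B (Y \<omega>) :: real)" if "\<omega> \<in> space M" for \<omega>
      using that by (simp add: A indicator_def)
    have i: "integrable (S \<Otimes>\<^sub>M T) (\<lambda>(x, y). indicator B y * (\<phi> x * p (x, y)))"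
      by (rule Bochner_Integration.integrable_bound[OF \<phi>p]) (auto simp: indicator_def)
    have "(\<integral>\<omega>\<in>A. \<phi> (X \<omega>) \<partial>M) = (\<integral>\<omega>. indicator B (Y \<omega>) * \<phi> (X \<omega>) \<partial>M)"
      unfolding set_lebesgue_integral_def
      by (rule Bochner_Integration.integral_cong) (auto simp: ind)
    also have "\<dots> = (\<integral>z. p z * (indicator B (snd z) * \<phi> (fst z)) \<partial>(S \<Otimes>\<^sub>M T))"
      by (subst distributed_integral[OF D]) (simp_all add: p0)
    also have "\<dots> = (\<integral>y. \<integral>x. indicator B y * (\<phi> x * p (x, y)) \<partial>S \<partial>T)"
      by (subst ST.integral_snd[OF i]) (simp add: case_prod_unfold ac_simps)
    also have "\<dots> = (\<integral>y. Z y * (indicator B y * G y) \<partial>T)"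
      by (rule integral_cong_AE, simp, simp, use ZG in eventually_elim) simp
    also have "\<dots> = (\<integral>\<omega>. indicator B (Y \<omega>) * G (Y \<omega>) \<partial>M)"
      by (subst distributed_integral[OF DY]) (simp_all add: Z0)
    also have "\<dots> = (\<integral>\<omega>\<in>A. G (Y \<omega>) \<partial>M)"
      unfolding set_lebesgue_integral_def
      by (rule Bochner_Integration.integral_cong) (auto simp: ind)
    finally show "(\<integral>\<omega>\<in>A. \<phi> (X \<omega>) \<partial>M) = (\<integral>\<omega>\<in>A. G (Y \<omega>) \<partial>M)" .
  qed simp
  then show ?thesis by (simp add: G_def Z_def)
qed

theorem proposition1:
  fixes M :: "'a measure"
    and Q :: "'a \<Rightarrow> real ^ 'n"
    and \<Xi> :: "'a \<Rightarrow> real ^ 'm"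
    and \<pi>Q :: "real ^ 'n \<Rightarrow> real"
    and \<pi>\<Xi> :: "real ^ 'm \<Rightarrow> real"
    and D :: "(real ^ 'k) set"
    and d :: "real ^ 'k"
    and h :: "real ^ 'n \<Rightarrow> real ^ 'k \<Rightarrow> real ^ 'm"
  assumes "prob_space M"
    and "d \<in> D"
    and "(\<lambda>q. h q d) \<in> borel_measurable borel"
    and "\<And>q. 0 \<le> \<pi>Q q" and "distributed M lborel Q (\<lambda>q. ennreal (\<pi>Q q))"
    and "\<And>x. 0 \<le> \<pi>\<Xi> x" and "distributed M lborel \<Xi> (\<lambda>x. ennreal (\<pi>\<Xi> x))"
    and "absolutely_continuous lborel (distr M borel (observation h Q \<Xi> d))"
    and "indep_rvs M Q \<Xi>"
    and "finite_variance M Q"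
    and "finite_variance M \<Xi>"
    and "finite_variance M (observation h Q \<Xi> d)"
  shows "total_expected_cond_variance M Q \<Xi> \<pi>Q \<pi>\<Xi> h d =
    (\<integral>\<omega>. (norm (Q \<omega> - vec_cond_exp M (observation h Q \<Xi> d) Q \<omega>))\<^sup>2 \<partial>M)"
proof -
  interpret prob_space M by fact
  note [measurable] = assms(3)
  define Y where "Y = observation h Q \<Xi> d"
  have Q[measurable]: "Q \<in> borel_measurable M" and X[measurable]: "\<Xi> \<in> borel_measurable M"
    using distributed_measurable[OF assms(5)] distributed_measurable[OF assms(7)] by simp_all
  have Yeq: "Y = (\<lambda>\<omega>. h (Q \<omega>) d + \<Xi> \<omega>)" by (simp add: Y_def observation_def fun_eq_iff)
  have Y[measurable]: "Y \<in> borel_measurable M" unfolding Yeq by simp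
  let ?F = "vimage_algebra (space M) Y borel"
  have sub: "subalgebra M ?F"
    unfolding subalgebra_def using sets_image_in_sets[OF refl Y] by simp
  define p where "p z = \<pi>Q (fst z) * \<pi>\<Xi> (snd z - h (fst z) d)" for z
  \<comment> \<open>\<open>distr\<close> depends on its target only through the measurable sets,
    which \<open>borel\<close> and \<open>lborel\<close> share; \<open>F_eq\<close> below rests on
    the same fact.\<close>
  have cong: "distr M lborel Q = distr M borel Q" "distr M lborel \<Xi> = distr M borel \<Xi>"
    "distr M (lborel \<Otimes>\<^sub>M lborel) (\<lambda>\<omega>. (Q \<omega>, \<Xi> \<omega>)) = distr M (borel \<Otimes>\<^sub>M borel) (\<lambda>\<omega>. (Q \<omega>, \<Xi> \<omega>))"
    by (auto intro!: distr_cong sets_pair_measure_cong)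
  have "distributed M (lborel \<Otimes>\<^sub>M lborel) (\<lambda>\<omega>. (Q \<omega>, \<Xi> \<omega>)) (\<lambda>(x, y). ennreal (\<pi>Q x) * ennreal (\<pi>\<Xi> y))"
    using assms(5,7) indep_rvs_distr_pair[OF Q X assms(9)]
    by (intro distributed_joint_indep') (simp_all add: cong sigma_finite_lborel)
  from distributed_shear[OF this assms(3)]
  have D: "distributed M (lborel \<Otimes>\<^sub>M lborel) (\<lambda>\<omega>. (Q \<omega>, Y \<omega>)) (\<lambda>z. ennreal (p z))"
    using assms(4,6) by (simp add: Yeq p_def case_prod_unfold ennreal_mult)
  have F_eq: "vimage_algebra (space M) Y lborel = ?F"
    by (intro measure_eqI) (simp_all add: sets_vimage_algebra emeasure_sigma vimage_algebra_def)
  have post: "AE \<omega> in M. real_cond_exp M ?F (\<lambda>\<omega>. \<phi> (Q \<omega>)) \<omega> =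
      (\<integral>q. \<phi> q * posterior_density \<pi>Q \<pi>\<Xi> h d (Y \<omega>) q \<partial>lborel)"
    if "\<phi> \<in> borel_measurable borel" "integrable M (\<lambda>\<omega>. \<phi> (Q \<omega>))" for \<phi>
    using real_cond_exp_eq_posterior_mean[OF sigma_finite_lborel sigma_finite_lborel D _ _ that(2)]
      that(1) assms(4,6)
    by (simp add: p_def posterior_density_def F_eq)
  have int1: "integrable M (\<lambda>\<omega>. Q \<omega> $ i)"
    and intv: "integrable M (\<lambda>\<omega>. (Q \<omega> $ i - (\<integral>\<omega>'. Q \<omega>' $ i \<partial>M))\<^sup>2)" for i
    using assms(10) by (simp_all add: finite_variance_def)
  \<comment> \<open>Finite variance bounds the centred square; expanding around the mean recovers
    the raw second moment.\<close>
  have int2: "integrable M (\<lambda>\<omega>. (Q \<omega> $ i)\<^sup>2)" for i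
  proof -
    let ?m = "\<integral>\<omega>. Q \<omega> $ i \<partial>M"
    have "(Q \<omega> $ i)\<^sup>2 = (Q \<omega> $ i - ?m)\<^sup>2 + 2 * ?m * (Q \<omega> $ i) - ?m\<^sup>2" for \<omega>
      by (simp add: power2_eq_square algebra_simps)
    then show ?thesis using int1 intv by simp
  qed
  have comp: "(\<lambda>q::real^'n. q $ i) \<in> borel_measurable borel" for i
    by (intro borel_measurable_continuous_onI continuous_intros)
  have comp2: "(\<lambda>q::real^'n. (q $ i)\<^sup>2) \<in> borel_measurable borel" for i
    by (intro borel_measurable_continuous_onI continuous_intros)
  have Qi[measurable]: "(\<lambda>\<omega>. Q \<omega> $ i) \<in> borel_measurable M" for i
    using int1 by auto
  note err = cond_exp_square_error[OF sub Qi int2]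
  let ?C = "\<lambda>i. real_cond_exp M ?F (\<lambda>\<omega>. Q \<omega> $ i)"
  let ?C2 = "\<lambda>i. real_cond_exp M ?F (\<lambda>\<omega>. (Q \<omega> $ i)\<^sup>2)"
  have pv: "AE \<omega> in M. posterior_variance \<pi>Q \<pi>\<Xi> h d i (Y \<omega>) = ?C2 i \<omega> - (?C i \<omega>)\<^sup>2" for i
    using post[OF comp int1[of i]] post[OF comp2 int2[of i]]
    by eventually_elim (simp add: posterior_variance_def)
  have "\<pi>Q \<in> borel_measurable lborel" "\<pi>\<Xi> \<in> borel_measurable lborel"
    using distributed_real_measurable[OF _ assms(5)] distributed_real_measurable[OF _ assms(7)] assms(4,6)
    by simp_all
  then have [measurable]: "\<pi>Q \<in> borel_measurable borel" "\<pi>\<Xi> \<in> borel_measurable borel" by simp_all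
  \<comment> \<open>Replacing an integrand by an almost everywhere equal one requires both to be
    measurable, which \<open>pv\<close> alone does not give.\<close>
  have pvm: "posterior_variance \<pi>Q \<pi>\<Xi> h d i \<in> borel_measurable borel" for i
  proof -
    note [measurable] = comp
    show ?thesis unfolding posterior_variance_def posterior_density_def by measurable
  qed
  have "(\<integral>\<omega>. posterior_variance \<pi>Q \<pi>\<Xi> h d i (Y \<omega>) \<partial>M) = (\<integral>\<omega>. (Q \<omega> $ i - ?C i \<omega>)\<^sup>2 \<partial>M)" for i
    unfolding err(2) using pv[of i]
    by (intro integral_cong_AE measurable_compose[OF Y pvm]) simp_all
  then have "total_expected_cond_variance M Q \<Xi> \<pi>Q \<pi>\<Xi> h d =
      (\<Sum>i\<in>UNIV. \<integral>\<omega>. (Q \<omega> $ i - ?C i \<omega>)\<^sup>2 \<partial>M)"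
    by (simp add: total_expected_cond_variance_def Y_def)
  \<comment> \<open>Sum and integral commute because each squared error is integrable, by the first
    part of \<open>err\<close>.\<close>
  also have "\<dots> = (\<integral>\<omega>. (\<Sum>i\<in>UNIV. (Q \<omega> $ i - ?C i \<omega>)\<^sup>2) \<partial>M)"
    by (rule Bochner_Integration.integral_sum[symmetric]) (rule err(1))
  also have "\<dots> = (\<integral>\<omega>. (norm (Q \<omega> - vec_cond_exp M Y Q \<omega>))\<^sup>2 \<partial>M)"
    by (simp add: norm_vec_def L2_set_def sum_nonneg vec_cond_exp_def)
  finally show ?thesis unfolding Y_def .
qed

end
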